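(* Let $F$ be a field of arbitrary characteristic. Let $\widetilde{F}=F(\alpha)$ be a field extension of $F$ of degree $d$ and let $\varphi=N_{\widetilde{F}/F}$ be its norm, viewed as a form of degree $d$ on the $F$-vector space $\widetilde F$. Suppose that $K/F$ is a finite field extension which is linearly disjoint to $\widetilde{F}$ over $F$. If $e\in K^\times$ is represented by $\varphi_K$, then $N_{K/F}(e)$ is represented by $\varphi$, and thus $$N_{K/F}(G_K(\varphi_K))\subset G_F(\varphi).$$
   Context: For a form $\varphi:V\to F$ of degree $d$ (a homogeneous polynomial of degree $d$ after choosing a basis of the finite-dimensional $F$-vector space $V$) and a field extension $K/F$, $\varphi_K$ denotes the scalar extension of $\varphi$ to $V\otimes_F K$ (the same homogeneous polynomial over $K$). An element $a\in K$ is represented by $\varphi_K$ if $a=\varphi_K(v)$ for some $v\in V\otimes_FK$. Two forms $(V_1,\varphi_1)$, $(V_2,\varphi_2)$ are isomorphic, $\varphi_1\cong\varphi_2$, if there is a bijective linear map $f:V_1\to V_2$ with $\varphi_2(f(v))=\varphi_1(v)$ for all $v\in V_1$. The group of similarity factors is $G_K(\varphi_K)=\{a\in K^\times\mid a\varphi_K\cong\varphi_K\}$, and $G_F(\varphi)$ is the same with $K=F$. Linear disjointness of $K$ and $\widetilde F$ over $F$ means that $\widetilde F\otimes_F K\cong K(\alpha)$ is a field (of degree $d$ over $K$). *)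

theory Defs
  imports
    "HOL-Library.Poly_Mapping"
    "HOL-Algebra.QuotRing"
    "HOL-Algebra.Generated_Fields"
    "HOL-Algebra.Algebraic_Closure_Type"
    "Jordan_Normal_Form.Determinant"
begin

unbundle no fps_syntax

section \<open>Finite field extensions and norms\<close>

text \<open>
  A field extension is given by a homomorphism \<open>\<iota> :: 'f \<Rightarrow> 'l\<close> between fields
  (\<open>field_hom \<iota>\<close>); it turns \<open>'l\<close> into a vector space over \<open>'f\<close>.
\<close>

definition ext_scale :: "('f::field \<Rightarrow> 'l::field) \<Rightarrow> 'f \<Rightarrow> 'l \<Rightarrow> 'l" where
  "ext_scale \<iota> a x = \<iota> a * x"

definition finite_extension :: "('f::field \<Rightarrow> 'l::field) \<Rightarrow> bool" where
  "finite_extension \<iota> \<longleftrightarrow> (\<exists>B. finite B \<and> module.span (ext_scale \<iota>) B = UNIV)"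

definition extension_degree :: "('f::field \<Rightarrow> 'l::field) \<Rightarrow> nat" where
  "extension_degree \<iota> = vector_space.dim (ext_scale \<iota>) UNIV"

definition ordered_basis :: "('f::field \<Rightarrow> 'l::field) \<Rightarrow> 'l list \<Rightarrow> bool" where
  "ordered_basis \<iota> bs \<longleftrightarrow> distinct bs \<and>
     \<not> module.dependent (ext_scale \<iota>) (set bs) \<and> module.span (ext_scale \<iota>) (set bs) = UNIV"

definition simple_extension :: "('f::field \<Rightarrow> 'l::field) \<Rightarrow> 'l \<Rightarrow> bool" where
  "simple_extension \<iota> \<alpha> \<longleftrightarrow>
     generate_field ring_of_type_algebra (insert \<alpha> (range \<iota>)) = UNIV"

definition mult_mat :: "('f::field \<Rightarrow> 'l::field) \<Rightarrow> 'l list \<Rightarrow> 'l \<Rightarrow> 'f mat" where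
  "mult_mat \<iota> bs x = mat (length bs) (length bs)
     (\<lambda>(i, j). module.representation (ext_scale \<iota>) (set bs) (x * bs ! j) (bs ! i))"

text \<open>
  The norm is the determinant of multiplication by \<open>x\<close>; the choice of basis is immaterial,
  see \<open>field_norm_eq\<close> below.
\<close>

definition field_norm :: "('f::field \<Rightarrow> 'l::field) \<Rightarrow> 'l \<Rightarrow> 'f" where
  "field_norm \<iota> x = det (mult_mat \<iota> (SOME bs. ordered_basis \<iota> bs) x)"


section \<open>Tensor product of two extensions and linear disjointness\<close>

text \<open>
  The ring \<open>L \<otimes>\<^sub>F K\<close> is built as the monoid ring over the integers of the multiplicative
  monoid \<open>L \<times> K\<close>, modulo the relations of bi-additivity and \<open>F\<close>-balancedness.
  The additive subgroup generated by these relations is already an ideal, so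
  additively this is the usual quotient of the free abelian group on \<open>L \<times> K\<close>.
\<close>

definition pure_tensor :: "'l \<Rightarrow> 'k \<Rightarrow> ('l \<times> 'k) \<Rightarrow>\<^sub>0 int" where
  "pure_tensor x y = Poly_Mapping.single (x, y) 1"

definition formal_mult ::
  "(('l::comm_ring_1 \<times> 'k::comm_ring_1) \<Rightarrow>\<^sub>0 int) \<Rightarrow> (('l \<times> 'k) \<Rightarrow>\<^sub>0 int) \<Rightarrow> (('l \<times> 'k) \<Rightarrow>\<^sub>0 int)" where
  "formal_mult p q = (\<Sum>s\<in>Poly_Mapping.keys p. \<Sum>t\<in>Poly_Mapping.keys q.
     Poly_Mapping.single (fst s * fst t, snd s * snd t) (Poly_Mapping.lookup p s * Poly_Mapping.lookup q t))"

definition formal_ring :: "(('l::comm_ring_1 \<times> 'k::comm_ring_1) \<Rightarrow>\<^sub>0 int) ring" where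
  "formal_ring = \<lparr>carrier = UNIV, monoid.mult = formal_mult, one = pure_tensor 1 1,
     ring.zero = 0, add = (+)\<rparr>"

definition tensor_relations ::
  "('f \<Rightarrow> 'l::comm_ring_1) \<Rightarrow> ('f \<Rightarrow> 'k::comm_ring_1) \<Rightarrow> (('l \<times> 'k) \<Rightarrow>\<^sub>0 int) set" where
  "tensor_relations \<iota> \<kappa> =
     {pure_tensor (x + x') y - pure_tensor x y - pure_tensor x' y | x x' y. True} \<union>
     {pure_tensor x (y + y') - pure_tensor x y - pure_tensor x y' | x y y'. True} \<union>
     {pure_tensor (\<iota> a * x) y - pure_tensor x (\<kappa> a * y) | a x y. True}"

definition tensor_ring ::
  "('f \<Rightarrow> 'l::comm_ring_1) \<Rightarrow> ('f \<Rightarrow> 'k::comm_ring_1) \<Rightarrow> (('l \<times> 'k) \<Rightarrow>\<^sub>0 int) set ring" where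
  "tensor_ring \<iota> \<kappa> = formal_ring Quot (genideal formal_ring (tensor_relations \<iota> \<kappa>))"

definition linearly_disjoint :: "('f::field \<Rightarrow> 'l::field) \<Rightarrow> ('f \<Rightarrow> 'k::field) \<Rightarrow> bool" where
  "linearly_disjoint \<iota> \<kappa> \<longleftrightarrow> field (tensor_ring \<iota> \<kappa>)"


section \<open>Forms\<close>

text \<open>
  A form on an \<open>n\<close>-dimensional space with a chosen basis is a homogeneous polynomial in
  the variables \<open>0, \<dots>, n - 1\<close>, evaluated on coordinate vectors in \<open>carrier_vec n\<close>.
  Exponent vectors are finitely supported functions on the variables.
\<close>

type_synonym 'a mpolynomial = "(nat \<Rightarrow>\<^sub>0 nat) \<Rightarrow>\<^sub>0 'a"

definition is_form :: "nat \<Rightarrow> nat \<Rightarrow> 'a::zero mpolynomial \<Rightarrow> bool" where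
  "is_form n d \<phi> \<longleftrightarrow>
     (\<forall>m\<in>Poly_Mapping.keys \<phi>. Poly_Mapping.keys m \<subseteq> {..<n} \<and> (\<Sum>i\<in>Poly_Mapping.keys m. Poly_Mapping.lookup m i) = d)"

definition eval_form :: "'a::comm_semiring_1 mpolynomial \<Rightarrow> 'a vec \<Rightarrow> 'a" where
  "eval_form \<phi> v = (\<Sum>m\<in>Poly_Mapping.keys \<phi>. Poly_Mapping.lookup \<phi> m * (\<Prod>i\<in>Poly_Mapping.keys m. (v $ i) ^ Poly_Mapping.lookup m i))"

definition extend_scalars :: "('f::zero \<Rightarrow> 'k::zero) \<Rightarrow> 'f mpolynomial \<Rightarrow> 'k mpolynomial" where
  "extend_scalars \<kappa> \<phi> = Poly_Mapping.map \<kappa> \<phi>"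

definition scale_form :: "'a::field \<Rightarrow> 'a mpolynomial \<Rightarrow> 'a mpolynomial" where
  "scale_form a \<phi> = Poly_Mapping.map ((*) a) \<phi>"

definition represented_by :: "'a::field \<Rightarrow> nat \<Rightarrow> 'a mpolynomial \<Rightarrow> bool" where
  "represented_by a n \<phi> \<longleftrightarrow> (\<exists>v\<in>carrier_vec n. a = eval_form \<phi> v)"

definition isomorphic_forms ::
  "nat \<Rightarrow> 'a::field mpolynomial \<Rightarrow> nat \<Rightarrow> 'a mpolynomial \<Rightarrow> bool" where
  "isomorphic_forms n \<phi> m \<psi> \<longleftrightarrow> (\<exists>f. bij_betw f (carrier_vec n) (carrier_vec m) \<and>
     (\<forall>v\<in>carrier_vec n. \<forall>w\<in>carrier_vec n. f (v + w) = f v + f w) \<and>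
     (\<forall>c. \<forall>v\<in>carrier_vec n. f (c \<cdot>\<^sub>v v) = c \<cdot>\<^sub>v f v) \<and>
     (\<forall>v\<in>carrier_vec n. eval_form \<psi> (f v) = eval_form \<phi> v))"

definition similarity_factors :: "nat \<Rightarrow> 'a::field mpolynomial \<Rightarrow> 'a set" where
  "similarity_factors n \<phi> = {a. a \<noteq> 0 \<and> isomorphic_forms n (scale_form a \<phi>) n \<phi>}"

text \<open>
  The norm form in coordinates with respect to \<open>bs\<close>: the determinant, over the polynomial
  ring, of multiplication by the generic element \<open>\<Sum>k. X\<^sub>k * bs ! k\<close>. Over a finite field
  the values of the norm alone would not determine this polynomial.
\<close>

definition norm_form :: "('f::field \<Rightarrow> 'l::field) \<Rightarrow> 'l list \<Rightarrow> 'f mpolynomial" where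
  "norm_form \<iota> bs = det (mat (length bs) (length bs) (\<lambda>(i, j).
     \<Sum>k<length bs. Poly_Mapping.single (Poly_Mapping.single k 1) (mult_mat \<iota> bs (bs ! k) $$ (i, j))))"


section \<open>Basic properties\<close>

lemma pm_induct [case_names zero single add]:
  fixes p :: "'a \<Rightarrow>\<^sub>0 'b::comm_monoid_add"
  assumes "P 0" "\<And>k v. P (Poly_Mapping.single k v)" "\<And>p q. P p \<Longrightarrow> P q \<Longrightarrow> P (p + q)"
  shows "P p"
proof (induction p rule: update_induct)
  case const
  then show ?case using assms(1) by simp
next
  case (update p a b)
  have "Poly_Mapping.update a b p = Poly_Mapping.single a b + p"
    using update(1) by (intro poly_mapping_eqI)
      (auto simp: lookup_update lookup_add lookup_single when_def in_keys_iff)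
  then show ?case using assms(2,3) update by metis
qed

subsection \<open>The formal ring\<close>

lemma formal_mult_superset:
  assumes "finite A" "Poly_Mapping.keys p \<subseteq> A" "finite B" "Poly_Mapping.keys q \<subseteq> B"
  shows "formal_mult p q = (\<Sum>s\<in>A. \<Sum>t\<in>B.
     Poly_Mapping.single (fst s * fst t, snd s * snd t) (Poly_Mapping.lookup p s * Poly_Mapping.lookup q t))"
proof -
  have "(\<Sum>t\<in>Poly_Mapping.keys q. Poly_Mapping.single (fst s * fst t, snd s * snd t) (Poly_Mapping.lookup p s * Poly_Mapping.lookup q t)) =
        (\<Sum>t\<in>B. Poly_Mapping.single (fst s * fst t, snd s * snd t) (Poly_Mapping.lookup p s * Poly_Mapping.lookup q t))" for s
    using assms by (intro sum.mono_neutral_left) (auto simp: in_keys_iff)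
  moreover have "(\<Sum>s\<in>Poly_Mapping.keys p. \<Sum>t\<in>B. Poly_Mapping.single (fst s * fst t, snd s * snd t) (Poly_Mapping.lookup p s * Poly_Mapping.lookup q t)) =
        (\<Sum>s\<in>A. \<Sum>t\<in>B. Poly_Mapping.single (fst s * fst t, snd s * snd t) (Poly_Mapping.lookup p s * Poly_Mapping.lookup q t))"
    using assms by (intro sum.mono_neutral_left) (auto simp: in_keys_iff)
  ultimately show ?thesis unfolding formal_mult_def by simp
qed

lemma formal_mult_add_left: "formal_mult (p + p') q = formal_mult p q + formal_mult p' q"
proof -
  let ?A = "Poly_Mapping.keys p \<union> Poly_Mapping.keys p'"
  have "Poly_Mapping.keys (p + p') \<subseteq> ?A" by (rule keys_add)
  then show ?thesis
    by (simp add: formal_mult_superset[of ?A _ "Poly_Mapping.keys q"] lookup_add distrib_right single_add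
        sum.distrib)
qed

lemma formal_mult_commute: "formal_mult p q = formal_mult q p"
  unfolding formal_mult_def by (subst sum.swap) (simp add: mult.commute)

lemma formal_mult_add_right: "formal_mult q (p + p') = formal_mult q p + formal_mult q p'"
  by (metis formal_mult_add_left formal_mult_commute)

lemma formal_mult_0: "formal_mult 0 q = 0" "formal_mult q 0 = 0"
  by (simp_all add: formal_mult_def)

lemma formal_mult_single:
  "formal_mult (Poly_Mapping.single s a) (Poly_Mapping.single t b) =
   Poly_Mapping.single (fst s * fst t, snd s * snd t) (a * b)"
  by (subst formal_mult_superset[of "{s}" _ "{t}"]) auto

lemma formal_mult_assoc: "formal_mult (formal_mult p q) r = formal_mult p (formal_mult q r)"
proof (induction p rule: pm_induct)
  case (single k v)
  show ?case
  proof (induction q rule: pm_induct)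
    case (single k' v')
    show ?case
      by (induction r rule: pm_induct)
        (simp_all add: formal_mult_single formal_mult_add_left formal_mult_add_right
          formal_mult_0 mult.assoc)
  qed (simp_all add: formal_mult_add_left formal_mult_add_right formal_mult_0)
qed (simp_all add: formal_mult_add_left formal_mult_0)

lemma formal_mult_one: "formal_mult (pure_tensor 1 1) q = q"
  by (induction q rule: pm_induct)
    (simp_all add: formal_mult_single formal_mult_add_right formal_mult_0 pure_tensor_def)

lemma cring_formal_ring: "cring (formal_ring :: (('l::comm_ring_1 \<times> 'k::comm_ring_1) \<Rightarrow>\<^sub>0 int) ring)"
proof (intro cringI abelian_groupI comm_monoidI)
  fix x :: "('l \<times> 'k) \<Rightarrow>\<^sub>0 int"
  show "\<exists>y\<in>carrier formal_ring. y \<oplus>\<^bsub>formal_ring\<^esub> x = \<zero>\<^bsub>formal_ring\<^esub>"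
    by (rule bexI[of _ "- x"]) (auto simp: formal_ring_def)
next
  fix x y :: "('l \<times> 'k) \<Rightarrow>\<^sub>0 int"
  show "x \<otimes>\<^bsub>formal_ring\<^esub> y = y \<otimes>\<^bsub>formal_ring\<^esub> x"
    by (simp add: formal_ring_def formal_mult_commute)
qed (simp_all add: formal_ring_def ac_simps formal_mult_assoc formal_mult_one
      formal_mult_add_left formal_mult_add_right)

lemma cring_tensor_ring: "cring (tensor_ring \<iota> \<kappa>)"
proof -
  interpret cring formal_ring by (rule cring_formal_ring)
  have "ideal (genideal formal_ring (tensor_relations \<iota> \<kappa>)) formal_ring"
    by (rule genideal_ideal) (simp add: formal_ring_def)
  then show ?thesis
    unfolding tensor_ring_def by (rule ideal.quotient_is_cring) (rule cring_formal_ring)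
qed

subsection \<open>Coordinates and the norm\<close>

lemma vector_space_ext_scale:
  assumes "field_hom \<iota>"
  shows "vector_space (ext_scale \<iota>)"
proof -
  interpret field_hom \<iota> by fact
  show ?thesis by unfold_locales (simp_all add: ext_scale_def algebra_simps hom_add hom_mult)
qed

context
  fixes \<iota> :: "'f::field \<Rightarrow> 'l::field"
  assumes hom: "field_hom \<iota>"
begin

interpretation field_hom \<iota> by (rule hom)
interpretation vs: vector_space "ext_scale \<iota>" by (rule vector_space_ext_scale[OF hom])

lemma ordered_basis_exists:
  assumes "finite_extension \<iota>"
  shows "\<exists>bs. ordered_basis \<iota> bs"
proof -
  obtain A where A: "finite A" "vs.span A = UNIV"
    using assms by (auto simp: finite_extension_def)
  obtain B where B: "B \<subseteq> A" "vs.independent B" "A \<subseteq> vs.span B"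
    using vs.maximal_independent_subset[of A] by blast
  have "vs.span B = UNIV" using A(2) B(3) vs.span_mono vs.span_span by (metis top.extremum_uniqueI)
  moreover obtain bs where "set bs = B" "distinct bs"
    using A B finite_distinct_list finite_subset by metis
  ultimately show ?thesis using B by (auto simp: ordered_basis_def)
qed

lemma length_ordered_basis:
  assumes "ordered_basis \<iota> bs"
  shows "length bs = extension_degree \<iota>"
  using assms vs.dim_unique[of "set bs" UNIV]
  by (auto simp: ordered_basis_def extension_degree_def distinct_card)

lemma expand_in_basis:
  assumes "ordered_basis \<iota> bs"
  shows "(\<Sum>k<length bs. ext_scale \<iota> (vs.representation (set bs) x (bs ! k)) (bs ! k)) = x"
proof -
  have "(\<Sum>b\<in>set bs. ext_scale \<iota> (vs.representation (set bs) x b) b) = x"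
    using assms by (intro vs.sum_representation_eq) (auto simp: ordered_basis_def)
  moreover have "bij_betw ((!) bs) {..<length bs} (set bs)"
    using assms by (auto simp: ordered_basis_def intro: bij_betw_nth)
  ultimately show ?thesis by (simp add: sum.reindex_bij_betw[symmetric])
qed

lemma representation_lincomb:
  assumes "ordered_basis \<iota> bs"
  shows "vs.representation (set bs) (\<Sum>k\<in>I. ext_scale \<iota> (c k) (y k)) b =
         (\<Sum>k\<in>I. c k * vs.representation (set bs) (y k) b)"
proof -
  have *: "vs.independent (set bs)" "\<And>v. v \<in> vs.span (set bs)"
    using assms by (auto simp: ordered_basis_def)
  show ?thesis
    by (subst vs.representation_sum[OF *(1)]) (auto simp: * vs.representation_scale)
qed

lemma field_norm_eq:
  assumes bs: "ordered_basis \<iota> bs"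
  shows "field_norm \<iota> x = det (mult_mat \<iota> bs x)"
proof -
  define cs where "cs = (SOME bs. ordered_basis \<iota> bs)"
  have cs: "ordered_basis \<iota> cs" unfolding cs_def by (rule someI) (rule bs)
  define d where "d = length bs"
  have len: "length bs = d" "length cs = d"
    using length_ordered_basis[OF bs] length_ordered_basis[OF cs] by (simp_all add: d_def)
  have dist: "distinct bs" and ind: "vs.independent (set bs)"
    using bs by (simp_all add: ordered_basis_def)
  let ?r = "\<lambda>as v i. vs.representation (set as) v (as ! i)"
  define P where "P as as' = mat d d (\<lambda>(i, j). ?r as (as' ! j) i)" for as as'
  have P [simp]: "P as as' \<in> carrier_mat d d" for as as' by (simp add: P_def)
  have M [simp]: "mult_mat \<iota> bs x \<in> carrier_mat d d" "mult_mat \<iota> cs x \<in> carrier_mat d d"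
    by (simp_all add: mult_mat_def len)
  have expand: "?r as v i = (\<Sum>k<d. ?r as (as' ! k) i * ?r as' v k)"
    if "ordered_basis \<iota> as" "ordered_basis \<iota> as'" for as as' v i
  proof -
    have "length as' = d" using length_ordered_basis[OF that(2)] length_ordered_basis[OF bs] len by simp
    then have "?r as v i = ?r as (\<Sum>k<d. ext_scale \<iota> (?r as' v k) (as' ! k)) i"
      using expand_in_basis[OF that(2), of v] by simp
    then show ?thesis by (simp add: representation_lincomb[OF that(1)] mult.commute)
  qed
  have inv: "P bs cs * P cs bs = 1\<^sub>m d"
  proof (rule eq_matI)
    fix i j assume "i < dim_row (1\<^sub>m d :: 'f mat)" "j < dim_col (1\<^sub>m d :: 'f mat)"
    then have ij: "i < d" "j < d" by auto
    have "(P bs cs * P cs bs) $$ (i, j) = ?r bs (bs ! j) i"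
      using ij by (simp add: P_def scalar_prod_def expand[OF bs cs, of "bs ! j"] atLeast0LessThan)
    also have "\<dots> = (1\<^sub>m d :: 'f mat) $$ (i, j)"
      using ij dist len by (auto simp: vs.representation_basis[OF ind] nth_eq_iff_index_eq)
    finally show "(P bs cs * P cs bs) $$ (i, j) = (1\<^sub>m d :: 'f mat) $$ (i, j)" .
  qed (auto simp: P_def)
  have comm: "mult_mat \<iota> bs x * P bs cs = P bs cs * mult_mat \<iota> cs x"
  proof (rule eq_matI)
    fix i j assume "i < dim_row (P bs cs * mult_mat \<iota> cs x)" "j < dim_col (P bs cs * mult_mat \<iota> cs x)"
    then have ij: "i < d" "j < d" by (auto simp: P_def mult_mat_def len)
    have "x * cs ! j = (\<Sum>k<d. ext_scale \<iota> (?r bs (cs ! j) k) (x * bs ! k))"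
      by (subst expand_in_basis[OF bs, of "cs ! j", symmetric])
        (simp add: sum_distrib_left ext_scale_def len ac_simps)
    then have "?r bs (x * cs ! j) i = (\<Sum>k<d. ?r bs (x * bs ! k) i * ?r bs (cs ! j) k)"
      by (simp add: representation_lincomb[OF bs] mult.commute)
    then show "(mult_mat \<iota> bs x * P bs cs) $$ (i, j) = (P bs cs * mult_mat \<iota> cs x) $$ (i, j)"
      using ij expand[OF bs cs, of "x * cs ! j" i]
      by (simp add: P_def mult_mat_def scalar_prod_def len atLeast0LessThan)
  qed (auto simp: P_def mult_mat_def len)
  have "det (P bs cs) * det (P cs bs) = 1"
    using det_mult[OF P P, of bs cs cs bs] inv by simp
  then have "det (P bs cs) \<noteq> 0" by auto
  moreover have "det (mult_mat \<iota> bs x) * det (P bs cs) = det (P bs cs) * det (mult_mat \<iota> cs x)"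
    using det_mult[OF M(1) P, of bs cs] det_mult[OF P M(2), of bs cs] comm by metis
  ultimately show ?thesis by (auto simp: field_norm_def cs_def[symmetric])
qed

end

subsection \<open>The norm form\<close>

lemma eval_form_superset:
  assumes "finite A" "Poly_Mapping.keys p \<subseteq> A"
  shows "eval_form p v = (\<Sum>m\<in>A. Poly_Mapping.lookup p m * (\<Prod>i\<in>Poly_Mapping.keys m. (v $ i) ^ Poly_Mapping.lookup m i))"
  unfolding eval_form_def using assms by (intro sum.mono_neutral_left) (auto simp: in_keys_iff)

lemma eval_form_single:
  "eval_form (Poly_Mapping.single m c) v = c * (\<Prod>i\<in>Poly_Mapping.keys m. (v $ i) ^ Poly_Mapping.lookup m i)"
  by (subst eval_form_superset[of "{m}"]) auto

lemma eval_form_add: "eval_form (p + q) v = eval_form p v + eval_form q v"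
proof -
  have "Poly_Mapping.keys (p + q) \<subseteq> Poly_Mapping.keys p \<union> Poly_Mapping.keys q" by (rule keys_add)
  then show ?thesis
    by (simp add: eval_form_superset[of "Poly_Mapping.keys p \<union> Poly_Mapping.keys q"] lookup_add distrib_right sum.distrib)
qed

lemma eval_monomial_add:
  fixes m m' :: "nat \<Rightarrow>\<^sub>0 nat" and v :: "'a::comm_semiring_1 vec"
  shows "(\<Prod>i\<in>Poly_Mapping.keys (m + m'). (v $ i) ^ Poly_Mapping.lookup (m + m') i) =
    (\<Prod>i\<in>Poly_Mapping.keys m. (v $ i) ^ Poly_Mapping.lookup m i) * (\<Prod>i\<in>Poly_Mapping.keys m'. (v $ i) ^ Poly_Mapping.lookup m' i)"
proof -
  let ?A = "Poly_Mapping.keys m \<union> Poly_Mapping.keys m'"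
  have *: "(\<Prod>i\<in>Poly_Mapping.keys q. (v $ i) ^ Poly_Mapping.lookup q i) = (\<Prod>i\<in>?A. (v $ i) ^ Poly_Mapping.lookup q i)"
    if "Poly_Mapping.keys q \<subseteq> ?A" for q
    using that by (intro prod.mono_neutral_left) (auto simp: in_keys_iff)
  show ?thesis
    unfolding *[OF keys_add] *[OF Un_upper1] *[OF Un_upper2]
    by (simp add: lookup_add power_add prod.distrib)
qed

lemma eval_form_mult:
  fixes p q :: "'a::comm_ring_1 mpolynomial"
  shows "eval_form (p * q) v = eval_form p v * eval_form q v"
proof (induction p rule: pm_induct)
  case (single k c)
  show ?case
    by (induction q rule: pm_induct)
      (simp_all add: eval_form_single mult_single eval_monomial_add eval_form_add algebra_simps
        eval_form_def[of 0])
qed (simp_all add: eval_form_add distrib_right eval_form_def[of 0])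

lemma comm_ring_hom_eval_form: "comm_ring_hom (\<lambda>p. eval_form p v)"
proof
  show "eval_form 1 v = 1"
    using eval_form_single[of 0 1 v] by simp
qed (simp_all add: eval_form_add eval_form_mult eval_form_def[of 0])

lemma eval_norm_form:
  assumes hom: "field_hom \<iota>" and bs: "ordered_basis \<iota> bs"
  shows "eval_form (norm_form \<iota> bs) v = field_norm \<iota> (\<Sum>k<length bs. \<iota> (v $ k) * bs ! k)"
proof -
  interpret vs: vector_space "ext_scale \<iota>" by (rule vector_space_ext_scale[OF hom])
  interpret ev: comm_ring_hom "\<lambda>p. eval_form p v" by (rule comm_ring_hom_eval_form)
  let ?x = "\<Sum>k<length bs. \<iota> (v $ k) * bs ! k"
  have x: "?x * y = (\<Sum>k<length bs. ext_scale \<iota> (v $ k) (bs ! k * y))" for y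
    by (simp add: ext_scale_def sum_distrib_right mult.assoc)
  have "eval_form (norm_form \<iota> bs) v = det (mult_mat \<iota> bs ?x)"
    unfolding norm_form_def ev.hom_det[symmetric]
    by (rule arg_cong[where f = det], rule eq_matI)
      (simp_all add: mult_mat_def ev.hom_sum eval_form_single x representation_lincomb[OF hom bs],
        simp add: mult.commute)
  then show ?thesis by (simp add: field_norm_eq[OF hom bs])
qed

lemma represented_by_norm_form_iff:
  assumes hom: "field_hom \<iota>" and bs: "ordered_basis \<iota> bs"
  shows "represented_by a (length bs) (norm_form \<iota> bs) \<longleftrightarrow> (\<exists>x. a = field_norm \<iota> x)"
proof
  assume "\<exists>x. a = field_norm \<iota> x"
  then obtain x where x: "a = field_norm \<iota> x" by blast
  let ?v = "vec (length bs) (\<lambda>k. module.representation (ext_scale \<iota>) (set bs) x (bs ! k))"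
  have "(\<Sum>k<length bs. \<iota> (?v $ k) * bs ! k) = x"
    using expand_in_basis[OF hom bs, of x] by (simp add: ext_scale_def)
  then have "a = eval_form (norm_form \<iota> bs) ?v"
    by (simp only: eval_norm_form[OF hom bs] x)
  then show "represented_by a (length bs) (norm_form \<iota> bs)"
    unfolding represented_by_def by (intro bexI[of _ ?v]) auto
qed (auto simp: represented_by_def eval_norm_form[OF hom bs])

lemma is_form_add: "is_form n d p \<Longrightarrow> is_form n d q \<Longrightarrow> is_form n d (p + q)"
  using keys_add[of p q] by (auto simp: is_form_def)

lemma is_form_sum: "(\<And>i. i \<in> I \<Longrightarrow> is_form n d (p i)) \<Longrightarrow> is_form n d (sum p I)"
proof (induction I rule: infinite_finite_induct)
  case (insert i I)
  then show ?case by (simp add: is_form_add)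
qed (simp_all add: is_form_def)

lemma is_form_mult:
  fixes p q :: "'a::comm_ring_1 mpolynomial"
  assumes "is_form n d p" "is_form n e q"
  shows "is_form n (d + e) (p * q)"
  unfolding is_form_def
proof
  fix m assume "m \<in> Poly_Mapping.keys (p * q)"
  then obtain a b where ab: "m = a + b" "a \<in> Poly_Mapping.keys p" "b \<in> Poly_Mapping.keys q"
    using keys_mult[of p q] by blast
  let ?A = "Poly_Mapping.keys a \<union> Poly_Mapping.keys b"
  have s: "(\<Sum>i\<in>Poly_Mapping.keys c. Poly_Mapping.lookup c i) = (\<Sum>i\<in>?A. Poly_Mapping.lookup c i)"
    if "Poly_Mapping.keys c \<subseteq> ?A" for c :: "nat \<Rightarrow>\<^sub>0 nat"
    using that by (intro sum.mono_neutral_left) (auto simp: in_keys_iff)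
  have "(\<Sum>i\<in>Poly_Mapping.keys m. Poly_Mapping.lookup m i) = (\<Sum>i\<in>Poly_Mapping.keys a. Poly_Mapping.lookup a i) + (\<Sum>i\<in>Poly_Mapping.keys b. Poly_Mapping.lookup b i)"
    unfolding ab(1) s[OF keys_add] s[OF Un_upper1] s[OF Un_upper2]
    by (simp add: lookup_add sum.distrib)
  moreover have "Poly_Mapping.keys m \<subseteq> {..<n}"
    using keys_add[of a b] ab assms by (auto simp: is_form_def)
  ultimately show "Poly_Mapping.keys m \<subseteq> {..<n} \<and> (\<Sum>i\<in>Poly_Mapping.keys m. Poly_Mapping.lookup m i) = d + e"
    using ab assms by (simp add: is_form_def)
qed

lemma is_form_1: "is_form n 0 (1 :: 'a::comm_ring_1 mpolynomial)"
  by (simp add: is_form_def)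

lemma is_form_uminus: "is_form n d (- p) \<longleftrightarrow> is_form n d (p :: 'a::comm_ring_1 mpolynomial)"
  by (simp add: is_form_def in_keys_iff)

lemma is_form_prod:
  fixes p :: "'b \<Rightarrow> 'a::comm_ring_1 mpolynomial"
  assumes "finite I" "\<And>i. i \<in> I \<Longrightarrow> is_form n 1 (p i)"
  shows "is_form n (card I) (prod p I)"
  using assms
proof (induction I rule: finite_induct)
  case (insert i I)
  then show ?case using is_form_mult[of n 1 "p i" "card I" "prod p I"] by simp
qed (simp add: is_form_1)

lemma is_form_norm_form:
  fixes \<iota> :: "'f::field \<Rightarrow> 'l::field"
  shows "is_form (length bs) (length bs) (norm_form \<iota> bs)"
proof -
  let ?n = "length bs"
  let ?A = "mat ?n ?n (\<lambda>(i, j). \<Sum>k<?n.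
    Poly_Mapping.single (Poly_Mapping.single k 1) (mult_mat \<iota> bs (bs ! k) $$ (i, j)))"
  have entry: "is_form ?n 1 (?A $$ (i, j))" if "i < ?n" "j < ?n" for i j
  proof -
    have "is_form ?n 1 (Poly_Mapping.single (Poly_Mapping.single k 1) c)" if "k < ?n" for k and c :: 'f
      using that by (simp add: is_form_def)
    then have "is_form ?n 1 (\<Sum>k<?n.
        Poly_Mapping.single (Poly_Mapping.single k 1) (mult_mat \<iota> bs (bs ! k) $$ (i, j)))"
      by (intro is_form_sum) blast
    then show ?thesis using that by simp
  qed
  have sgn: "is_form ?n ?n (signof \<pi> * q)" if "is_form ?n ?n q" for \<pi> and q :: "'f mpolynomial"
    using that by (auto simp: sign_def is_form_uminus)
  have "is_form ?n ?n (\<Prod>i = 0..<?n. ?A $$ (i, \<pi> i))" if "\<pi> permutes {0..<?n}" for \<pi>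
  proof -
    have "\<pi> i < ?n" if "i < ?n" for i
      using permutes_in_image[OF \<open>\<pi> permutes _\<close>, of i] that by simp
    then have "is_form ?n 1 (?A $$ (i, \<pi> i))" if "i \<in> {0..<?n}" for i
      using that by (intro entry) auto
    then have "is_form ?n (card {0..<?n}) (\<Prod>i = 0..<?n. ?A $$ (i, \<pi> i))"
      by (intro is_form_prod) simp_all
    then show ?thesis by simp
  qed
  then have "is_form ?n ?n (\<Sum>\<pi>\<in>{\<pi>. \<pi> permutes {0..<?n}}. signof \<pi> * (\<Prod>i = 0..<?n. ?A $$ (i, \<pi> i)))"
    by (intro is_form_sum sgn) blast
  then show ?thesis unfolding norm_form_def by (subst det_def'[where n = ?n]) simp_all
qed

end

theory Submission
  imports Defs
begin

text \<open>
  Write \<open>e = \<phi>\<^sub>K(v)\<close> as the determinant over \<open>K\<close> of the matrix \<open>M = \<Sum>\<^sub>k v\<^sub>k A\<^sub>k\<close>, where \<open>A\<^sub>k\<close> is the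
  matrix over \<open>F\<close> of multiplication by the \<open>k\<close>-th basis element of \<open>L\<close>. Replacing each entry of \<open>M\<close>
  by its multiplication matrix over \<open>F\<close> gives a block matrix with determinant \<open>N\<^sub>K(e)\<close>.
  This block matrix lives on a tensor product; read with the two factors exchanged, its blocks are
  multiplication matrices of elements of \<open>L\<close>, the entries of a matrix \<open>C\<close> over \<open>L\<close>, so its
  determinant is also \<open>N\<^sub>L(det C)\<close>. A similarity factor of \<open>\<phi>\<^sub>K\<close> is represented
  by \<open>\<phi>\<^sub>K\<close> because \<open>1\<close> is, and a nonzero norm \<open>N\<^sub>L(x)\<close> is a similarity factor of \<open>\<phi>\<close>
  through multiplication by \<open>x\<close>.
\<close>

text \<open>Division with remainder by \<open>n\<close> identifies the indices below
  \<open>m * n\<close> with pairs; this splits the sum in a product of block matrices.\<close>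

lemma sum_div_mod:
  fixes f :: "nat \<Rightarrow> nat \<Rightarrow> 'a::comm_monoid_add"
  shows "(\<Sum>k<m * n. f (k div n) (k mod n)) = (\<Sum>i<m. \<Sum>j<n. f i j)"
proof -
  have "(\<Sum>k = i * n..<i * n + n. f (k div n) (k mod n)) = (\<Sum>j<n. f i j)" for i
    using sum.shift_bounds_nat_ivl[of "\<lambda>k. f (k div n) (k mod n)" 0 "i * n" n]
    by (auto simp: atLeast0LessThan add.commute intro!: sum.cong)
  then show ?thesis by (simp add: sum.nat_group[symmetric])
qed

section \<open>Block matrices\<close>

text \<open>The indices \<open>i\<close>, \<open>j\<close> number the blocks and \<open>p\<close>,
  \<open>q\<close> the entries within a block. With all four as arguments of one function,
  exchanging the tensor factors is a permutation of arguments.\<close>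

definition block_mat :: "nat \<Rightarrow> nat \<Rightarrow> (nat \<Rightarrow> nat \<Rightarrow> nat \<Rightarrow> nat \<Rightarrow> 'a) \<Rightarrow> 'a mat" where
  "block_mat m n f = mat (m * n) (m * n) (\<lambda>(i, j). f (i div n) (j div n) (i mod n) (j mod n))"

lemma block_mat_carrier [simp]: "block_mat m n f \<in> carrier_mat (m * n) (m * n)"
  by (simp add: block_mat_def)

lemma less_mult_imp_mod_less: "i < m * n \<Longrightarrow> i mod n < (n::nat)"
  by (cases n) auto

lemma block_mat_cong:
  assumes "\<And>i j p q. i < m \<Longrightarrow> j < m \<Longrightarrow> p < n \<Longrightarrow> q < n \<Longrightarrow> f i j p q = g i j p q"
  shows "block_mat m n f = block_mat m n g"
  unfolding block_mat_def
  by (rule cong_mat) (auto intro!: assms simp: less_mult_imp_div_less less_mult_imp_mod_less)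

lemma block_mat_mult:
  "block_mat m n f * block_mat m n g =
   block_mat m n (\<lambda>i j p q. \<Sum>k<m. \<Sum>r<n. f i k p r * g k j r q)"
  by (rule eq_matI)
    (auto simp: block_mat_def scalar_prod_def atLeast0LessThan
      sum_div_mod[of "\<lambda>k r. f _ k _ r * g k _ r _", symmetric])

text \<open>This is conjugation by a permutation matrix: the signs from the rows and from the
  columns cancel. Columns are reached by transposing.\<close>

lemma det_reindex:
  fixes A :: "'a::comm_ring_1 mat"
  assumes A: "A \<in> carrier_mat n n" and p: "p permutes {0..<n}"
  shows "det (mat n n (\<lambda>(i, j). A $$ (p i, p j))) = det A"
proof -
  have lt: "p i < n" if "i < n" for i
    using permutes_in_image[OF p, of i] that by simp
  let ?B = "mat n n (\<lambda>(i, j). A $$ (p i, j))"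
  have "mat n n (\<lambda>(i, j). A $$ (p i, p j)) =
      transpose_mat (mat n n (\<lambda>(i, j). transpose_mat ?B $$ (p i, j)))"
    by (rule eq_matI) (auto simp: lt)
  then have "det (mat n n (\<lambda>(i, j). A $$ (p i, p j))) =
      det (mat n n (\<lambda>(i, j). transpose_mat ?B $$ (p i, j)))"
    by (simp add: det_transpose[where n = n])
  also have "\<dots> = signof p * (signof p * det A)"
    by (simp add: det_permute_rows[OF _ p] A det_transpose[where n = n])
  also have "\<dots> = det A"
    by (simp add: sign_def)
  finally show ?thesis .
qed

lemma less_mult_add:
  fixes a b :: nat
  assumes "a < m" "b < n"
  shows "a * n + b < m * n"
proof -
  have "a * n + b < Suc a * n" using assms by simp
  also have "\<dots> \<le> m * n" using assms by (intro mult_right_mono) auto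
  finally show ?thesis .
qed

text \<open>Both matrices describe the same endomorphism of a tensor product, with the basis vectors
  listed in two orders.\<close>

lemma det_block_mat_swap:
  fixes f :: "nat \<Rightarrow> nat \<Rightarrow> nat \<Rightarrow> nat \<Rightarrow> 'a::comm_ring_1"
  shows "det (block_mat m n f) = det (block_mat n m (\<lambda>p q i j. f i j p q))"
proof -
  \<comment> \<open>\<open>?s m n\<close> sends the position of the pair (block, inner) to that of
    (inner, block).\<close>
  let ?s = "\<lambda>m n a. (a mod n) * m + a div n :: nat"
  have s: "?s m n a < m * n" "?s m n a div m = a mod n" "?s m n a mod m = a div n"
      "?s n m (?s m n a) = a"
    if "a < m * n" for a m n :: nat
  proof -
    have "a div n < m" "a mod n < n"
      using that by (auto simp: less_mult_imp_div_less less_mult_imp_mod_less)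
    then show "?s m n a < m * n" "?s m n a div m = a mod n" "?s m n a mod m = a div n"
      "?s n m (?s m n a) = a"
      using less_mult_add[of "a mod n" n "a div n" m] by (auto simp: mult.commute)
  qed
  \<comment> \<open>\<open>permutes\<close> demands the identity outside the index range.\<close>
  define p where "p a = (if a < m * n then ?s m n a else a)" for a
  have "bij_betw (?s m n) {0..<m * n} {0..<m * n}"
  proof (rule bij_betw_byWitness[where f' = "?s n m"])
    show "?s n m ` {0..<m * n} \<subseteq> {0..<m * n}"
      using s(1)[of _ n m] by (auto simp: mult.commute)
    show "\<forall>b\<in>{0..<m * n}. ?s m n (?s n m b) = b"
      using s(4)[of _ n m] by (auto simp: mult.commute)
  qed (use s in auto)
  then have "bij_betw p {0..<m * n} {0..<m * n}"
    by (rule bij_betw_cong[THEN iffD1, rotated]) (simp add: p_def)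
  then have p: "p permutes {0..<m * n}"
    by (rule bij_imp_permutes) (simp add: p_def)
  let ?B = "block_mat n m (\<lambda>p q i j. f i j p q)"
  have "block_mat m n f = mat (m * n) (m * n) (\<lambda>(i, j). ?B $$ (p i, p j))"
    by (rule eq_matI) (auto simp: block_mat_def p_def s mult.commute[of n m] less_mult_imp_div_less)
  then show ?thesis
    using det_reindex[OF _ p, of ?B] block_mat_carrier[of n m] by (metis mult.commute)
qed

lemma block_mat_Suc:
  "block_mat (Suc m) n f = four_block_mat (mat n n (\<lambda>(p, q). f 0 0 p q))
     (mat n (m * n) (\<lambda>(p, j). f 0 (Suc (j div n)) p (j mod n)))
     (mat (m * n) n (\<lambda>(i, q). f (Suc (i div n)) 0 (i mod n) q))
     (block_mat m n (\<lambda>i j. f (Suc i) (Suc j)))"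
proof (rule eq_matI)
  have *: "i div n = Suc ((i - n) div n)" "i mod n = (i - n) mod n" if "\<not> i < n" "i < n + m * n" for i
    using that by (cases "n = 0"; simp add: le_div_geq le_mod_geq)+
  fix i j
  let ?R = "four_block_mat (mat n n (\<lambda>(p, q). f 0 0 p q))
     (mat n (m * n) (\<lambda>(p, j). f 0 (Suc (j div n)) p (j mod n)))
     (mat (m * n) n (\<lambda>(i, q). f (Suc (i div n)) 0 (i mod n) q))
     (block_mat m n (\<lambda>i j. f (Suc i) (Suc j)))"
  assume "i < dim_row ?R" "j < dim_col ?R"
  then have "i < n + m * n" "j < n + m * n" by (auto simp: block_mat_def)
  then show "block_mat (Suc m) n f $$ (i, j) = ?R $$ (i, j)"
    using *[of i] *[of j] by (auto simp: block_mat_def)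
qed (auto simp: block_mat_def)

text \<open>Both triangular shapes occur below: a matrix whose first row has been cleared has the
  one, the matrix \<open>U\<close> that clears it the other.\<close>

lemma det_block_mat_Suc:
  fixes f :: "nat \<Rightarrow> nat \<Rightarrow> nat \<Rightarrow> nat \<Rightarrow> 'a::idom"
  assumes "(\<forall>j<m. \<forall>p<n. \<forall>q<n. f 0 (Suc j) p q = 0) \<or> (\<forall>j<m. \<forall>p<n. \<forall>q<n. f (Suc j) 0 p q = 0)"
  shows "det (block_mat (Suc m) n f) =
    det (mat n n (\<lambda>(p, q). f 0 0 p q)) * det (block_mat m n (\<lambda>i j. f (Suc i) (Suc j)))"
  using assms
proof
  assume *: "\<forall>j<m. \<forall>p<n. \<forall>q<n. f 0 (Suc j) p q = 0"
  have "mat n (m * n) (\<lambda>(p, j). f 0 (Suc (j div n)) p (j mod n)) = 0\<^sub>m n (m * n)"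
    by (rule eq_matI) (auto simp: * less_mult_imp_div_less less_mult_imp_mod_less)
  then show ?thesis
    unfolding block_mat_Suc by (intro det_four_block_mat_upper_right_zero) auto
next
  assume *: "\<forall>j<m. \<forall>p<n. \<forall>q<n. f (Suc j) 0 p q = 0"
  have "mat (m * n) n (\<lambda>(i, q). f (Suc (i div n)) 0 (i mod n) q) = 0\<^sub>m (m * n) n"
    by (rule eq_matI) (auto simp: * less_mult_imp_div_less less_mult_imp_mod_less)
  then show ?thesis
    unfolding block_mat_Suc by (intro det_four_block_mat_lower_left_zero) auto
qed

lemma det_mat_Suc:
  fixes M :: "'a::idom mat"
  assumes M: "M \<in> carrier_mat (Suc m) (Suc m)"
    and "(\<forall>j<m. M $$ (0, Suc j) = 0) \<or> (\<forall>j<m. M $$ (Suc j, 0) = 0)"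
  shows "det M = M $$ (0, 0) * det (mat m m (\<lambda>(i, j). M $$ (Suc i, Suc j)))"
proof -
  \<comment> \<open>Scalar entries are blocks of size 1, so the block version applies.\<close>
  have "M = block_mat (Suc m) 1 (\<lambda>i j p q. M $$ (i, j))"
    using M by (intro eq_matI) (auto simp: block_mat_def)
  moreover have "mat m m (\<lambda>(i, j). M $$ (Suc i, Suc j)) =
      block_mat m 1 (\<lambda>i j p q. M $$ (Suc i, Suc j))"
    by (intro eq_matI) (auto simp: block_mat_def)
  ultimately show ?thesis
    using det_block_mat_Suc[of m 1 "\<lambda>i j p q. M $$ (i, j)"] assms(2)
      det_single[of "mat 1 1 (\<lambda>(p, q). M $$ (0, 0))"] by auto
qed

section \<open>Matrix representations\<close>

text \<open>Abstracts the regular representation, so that one determinant formula serves both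
  extensions.\<close>

locale matrix_representation =
  fixes n :: nat and \<rho> :: "'k::field \<Rightarrow> 'f::idom mat"
  assumes carrier [simp]: "\<rho> x \<in> carrier_mat n n"
    and add: "\<rho> (x + y) = \<rho> x + \<rho> y"
    and mult: "\<rho> (x * y) = \<rho> x * \<rho> y"
    and one: "\<rho> 1 = 1\<^sub>m n"
begin

lemma dim [simp]: "dim_row (\<rho> x) = n" "dim_col (\<rho> x) = n"
  by (rule carrier_matD[OF carrier])+

lemma zero: "\<rho> 0 = 0\<^sub>m n n"
proof -
  have "\<rho> 0 $$ (i, j) = 0" if "i < n" "j < n" for i j
    using that arg_cong[OF add[of 0 0], of "\<lambda>A. A $$ (i, j)"]
    by (simp only: index_add_mat dim add_0 add_cancel_right_right)
  then show ?thesis by (intro eq_matI) simp_all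
qed

lemma index_sum: "p < n \<Longrightarrow> q < n \<Longrightarrow> \<rho> (\<Sum>k\<in>I. f k) $$ (p, q) = (\<Sum>k\<in>I. \<rho> (f k) $$ (p, q))"
proof (induction I rule: infinite_finite_induct)
  case (insert k I)
  then show ?case by (simp add: add)
qed (simp_all add: zero)

lemma index_mult:
  "p < n \<Longrightarrow> q < n \<Longrightarrow> \<rho> (x * y) $$ (p, q) = (\<Sum>r<n. \<rho> x $$ (p, r) * \<rho> y $$ (r, q))"
  by (simp add: mult scalar_prod_def atLeast0LessThan)

abbreviation blocks :: "nat \<Rightarrow> 'k mat \<Rightarrow> 'f mat" where
  "blocks m M \<equiv> block_mat m n (\<lambda>i j p q. \<rho> (M $$ (i, j)) $$ (p, q))"

text \<open>Applying a ring homomorphism entrywise respects matrix products, so column operations on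
  \<open>M\<close> carry over to its blocks.\<close>

lemma blocks_mult:
  assumes M: "M \<in> carrier_mat m m" and E: "E \<in> carrier_mat m m"
  shows "blocks m (M * E) = blocks m M * blocks m E"
  unfolding block_mat_mult using M E
  by (intro block_mat_cong) (auto simp: scalar_prod_def index_sum index_mult atLeast0LessThan)

lemma det_mult_hom: "det (\<rho> (x * y)) = det (\<rho> x) * det (\<rho> y)"
  unfolding mult by (rule det_mult[where n = n]) auto

text \<open>In this shape both determinants split into a factor from the corner and one from the
  minor, to which \<open>IH\<close> applies.\<close>

lemma det_blocks_clear:
  assumes M: "M \<in> carrier_mat (Suc m) (Suc m)"
    and z: "(\<forall>j<m. M $$ (0, Suc j) = 0) \<or> (\<forall>j<m. M $$ (Suc j, 0) = 0)"
    and IH: "\<And>M. M \<in> carrier_mat m m \<Longrightarrow> det (blocks m M) = det (\<rho> (det M))"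
  shows "det (blocks (Suc m) M) = det (\<rho> (det M))"
proof -
  let ?D = "mat m m (\<lambda>(i, j). M $$ (Suc i, Suc j))"
  have "det (blocks (Suc m) M) = det (mat n n (\<lambda>(p, q). \<rho> (M $$ (0, 0)) $$ (p, q))) *
      det (block_mat m n (\<lambda>i j p q. \<rho> (M $$ (Suc i, Suc j)) $$ (p, q)))"
    using z by (intro det_block_mat_Suc) (auto simp: zero)
  also have "mat n n (\<lambda>(p, q). \<rho> (M $$ (0, 0)) $$ (p, q)) = \<rho> (M $$ (0, 0))"
    by (rule eq_matI) auto
  also have "block_mat m n (\<lambda>i j p q. \<rho> (M $$ (Suc i, Suc j)) $$ (p, q)) = blocks m ?D"
    by (rule block_mat_cong) simp
  also have "det (blocks m ?D) = det (\<rho> (det ?D))" by (rule IH) simp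
  finally show ?thesis by (simp add: det_mat_Suc[OF M z] det_mult_hom)
qed

text \<open>Multiplying by \<open>E\<close> changes neither side, since \<open>bE\<close> and
  \<open>E1\<close> give the blocks of \<open>E\<close> determinant 1. The claim may thus be proved
  for \<open>M * E\<close> instead.\<close>

lemma det_blocks_cancel:
  assumes M: "M \<in> carrier_mat m m" and E: "E \<in> carrier_mat m m" and E1: "det E = 1"
    and bE: "det (blocks m E) = det (\<rho> (det E))"
    and ME: "det (blocks m (M * E)) = det (\<rho> (det (M * E)))"
  shows "det (blocks m M) = det (\<rho> (det M))"
  using ME bE
  unfolding blocks_mult[OF M E] det_mult[OF M E] det_mult[OF block_mat_carrier block_mat_carrier] E1
  by (simp add: one)

text \<open>
  Induction on \<open>m\<close>: unipotent column operations clear the first row of \<open>M\<close> outside the corner,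
  and then both sides factor through the corner and the remaining minor.
\<close>

lemma det_blocks:
  "M \<in> carrier_mat m m \<Longrightarrow> det (blocks m M) = det (\<rho> (det M))"
proof (induction m arbitrary: M)
  case 0
  then have "det M = 1" "det (blocks 0 M) = 1"
    by (auto intro!: det_dim_zero simp: block_mat_def)
  then show ?case by (simp add: one)
next
  case (Suc m)
  note clear = det_blocks_clear[OF _ _ Suc.IH]
  have pivot: "det (blocks (Suc m) M) = det (\<rho> (det M))"
    if M: "M \<in> carrier_mat (Suc m) (Suc m)" and a: "M $$ (0, 0) \<noteq> 0" for M
  proof -
    \<comment> \<open>Multiplication by \<open>U\<close> on the right subtracts from each later
      column the multiple of column 0 that kills its entry in row 0.\<close>
    define U where "U = mat (Suc m) (Suc m)
      (\<lambda>(i, j). if i = j then 1 else if i = 0 then - M $$ (0, j) / M $$ (0, 0) else 0)"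
    have U: "U \<in> carrier_mat (Suc m) (Suc m)" by (simp add: U_def)
    \<comment> \<open>\<open>U\<close> itself vanishes below the corner, so \<open>clear\<close>
      also supplies the identity for \<open>U\<close> that \<open>det_blocks_cancel\<close> asks
      for.\<close>
    have zU: "\<forall>j<m. U $$ (Suc j, 0) = 0" by (simp add: U_def)
    have "mat m m (\<lambda>(i, j). U $$ (Suc i, Suc j)) = 1\<^sub>m m"
      by (rule eq_matI) (auto simp: U_def)
    then have "det U = 1"
      using zU by (subst det_mat_Suc[OF U]) (auto simp: U_def)
    moreover have "(M * U) $$ (0, Suc j) = 0" if "j < m" for j
    proof -
      have "(M * U) $$ (0, Suc j) = (\<Sum>k<Suc m. M $$ (0, k) * U $$ (k, Suc j))"
        using M U that by (simp add: scalar_prod_def atLeast0LessThan)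
      also have "\<dots> = (\<Sum>k\<in>{0, Suc j}. M $$ (0, k) * U $$ (k, Suc j))"
        using that by (intro sum.mono_neutral_right) (auto simp: U_def)
      also have "\<dots> = 0" using a that by (simp add: U_def)
      finally show ?thesis .
    qed
    ultimately show ?thesis
      using M U zU by (intro det_blocks_cancel[OF M U] clear) auto
  qed
  show ?case
  proof (cases "\<forall>j<m. M $$ (0, Suc j) = 0")
    case True
    then show ?thesis using Suc.prems by (intro clear) auto
  next
    case False
    show ?thesis
    proof (cases "M $$ (0, 0) = 0")
      case True
      from False obtain l where l: "l < m" "M $$ (0, Suc l) \<noteq> 0" by blast
      \<comment> \<open>Adding column \<open>Suc l\<close> to column 0 turns the zero corner into
        the nonzero \<open>M $$ (0, Suc l)\<close>, so that \<open>pivot\<close> applies to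
        \<open>M * E\<close>.\<close>
      define E where "E = addrow_mat (Suc m) (1 :: 'k) (Suc l) 0"
      have E: "E \<in> carrier_mat (Suc m) (Suc m)" by (simp add: E_def)
      have zE: "\<forall>j<m. E $$ (0, Suc j) = 0" by (simp add: E_def addrow_mat_def)
      have "(M * E) $$ (0, 0) = (\<Sum>k<Suc m. M $$ (0, k) * E $$ (k, 0))"
        using Suc.prems E by (simp add: scalar_prod_def atLeast0LessThan)
      also have "\<dots> = (\<Sum>k\<in>{0, Suc l}. M $$ (0, k) * E $$ (k, 0))"
        using l by (intro sum.mono_neutral_right) (auto simp: E_def addrow_mat_def)
      also have "\<dots> \<noteq> 0" using l True by (simp add: E_def addrow_mat_def)
      finally have "(M * E) $$ (0, 0) \<noteq> 0" .
      moreover have "det E = 1" unfolding E_def by (rule det_addrow_mat) simp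
      ultimately show ?thesis
        using Suc.prems E zE by (intro det_blocks_cancel[OF Suc.prems E] clear pivot) auto
    qed (use pivot Suc.prems in blast)
  qed
qed

end

section \<open>Multiplication matrices\<close>

context
  fixes \<iota> :: "'f::field \<Rightarrow> 'l::field" and bs :: "'l list"
  assumes hom: "field_hom \<iota>" and bs: "ordered_basis \<iota> bs"
begin

interpretation vs: vector_space "ext_scale \<iota>" by (rule vector_space_ext_scale[OF hom])

text \<open>Linearity over the base field lets the two readings of the block matrix be compared
  entry by entry.\<close>

lemma mult_mat_lincomb:
  assumes "i < length bs" "j < length bs"
  shows "mult_mat \<iota> bs (\<Sum>k\<in>I. \<iota> (c k) * y k) $$ (i, j) = (\<Sum>k\<in>I. c k * mult_mat \<iota> bs (y k) $$ (i, j))"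
proof -
  have "(\<Sum>k\<in>I. \<iota> (c k) * y k) * bs ! j = (\<Sum>k\<in>I. ext_scale \<iota> (c k) (y k * bs ! j))"
    by (simp add: ext_scale_def sum_distrib_right mult.assoc)
  then show ?thesis using assms by (simp add: mult_mat_def representation_lincomb[OF hom bs])
qed

lemma matrix_representation_mult_mat: "matrix_representation (length bs) (mult_mat \<iota> bs)"
proof
  have ind: "vs.independent (set bs)" and span: "v \<in> vs.span (set bs)" and dist: "distinct bs" for v
    using bs by (auto simp: ordered_basis_def)
  fix x y
  show "mult_mat \<iota> bs x \<in> carrier_mat (length bs) (length bs)" by (simp add: mult_mat_def)
  show "mult_mat \<iota> bs (x + y) = mult_mat \<iota> bs x + mult_mat \<iota> bs y"
    by (rule eq_matI)
      (auto simp: mult_mat_def distrib_right vs.representation_add[OF ind span span])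
  show "mult_mat \<iota> bs 1 = 1\<^sub>m (length bs)"
    by (rule eq_matI)
      (auto simp: mult_mat_def vs.representation_basis[OF ind] dist nth_eq_iff_index_eq)
  let ?r = "\<lambda>v i. vs.representation (set bs) v (bs ! i)"
  \<comment> \<open>The columns of a multiplication matrix are coordinates of multiples of basis
    elements; expanding \<open>v\<close> in the basis turns composition into the matrix
    product.\<close>
  have expand: "?r (x * v) i = (\<Sum>k<length bs. ?r v k * ?r (x * bs ! k) i)" for v i
  proof -
    have "x * v = (\<Sum>k<length bs. ext_scale \<iota> (?r v k) (x * bs ! k))"
      by (subst expand_in_basis[OF hom bs, of v, symmetric])
        (simp add: sum_distrib_left ext_scale_def ac_simps)
    then show ?thesis by (simp add: representation_lincomb[OF hom bs])
  qed
  show "mult_mat \<iota> bs (x * y) = mult_mat \<iota> bs x * mult_mat \<iota> bs y"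
    by (rule eq_matI)
      (auto simp: mult_mat_def scalar_prod_def atLeast0LessThan mult.assoc expand[of "y * _"]
        mult.commute intro!: sum.cong)
qed

lemma field_norm_mult: "field_norm \<iota> (x * y) = field_norm \<iota> x * field_norm \<iota> y"
  using matrix_representation.det_mult_hom[OF matrix_representation_mult_mat]
  by (simp add: field_norm_eq[OF hom bs])

lemma field_norm_1: "field_norm \<iota> 1 = 1"
  using matrix_representation.one[OF matrix_representation_mult_mat]
  by (simp add: field_norm_eq[OF hom bs])

lemma field_norm_nonzero: "x \<noteq> 0 \<Longrightarrow> field_norm \<iota> x \<noteq> 0"
  using field_norm_mult[of x "inverse x"] field_norm_1 by auto

lemma field_norm_0: "field_norm \<iota> 0 = 0"
proof -
  \<comment> \<open>The empty matrix has determinant 1, so the basis must be nonempty: the span of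
    the empty set misses 1.\<close>
  have "bs \<noteq> []"
  proof
    assume "bs = []"
    then have "(1 :: 'l) \<in> {0}" using bs by (auto simp: ordered_basis_def)
    then show False by simp
  qed
  then have "det (0\<^sub>m (length bs) (length bs) :: 'f mat) = 0" by simp
  then show ?thesis
    using matrix_representation.zero[OF matrix_representation_mult_mat]
    by (simp add: field_norm_eq[OF hom bs])
qed

lemma mult_mat_vec_coordinates:
  assumes v: "v \<in> carrier_vec (length bs)"
  shows "(\<Sum>k<length bs. \<iota> ((mult_mat \<iota> bs x *\<^sub>v v) $ k) * bs ! k) =
    x * (\<Sum>k<length bs. \<iota> (v $ k) * bs ! k)"
proof -
  interpret field_hom \<iota> by (rule hom)
  have "(\<Sum>k<length bs. \<iota> ((mult_mat \<iota> bs x *\<^sub>v v) $ k) * bs ! k) =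
      (\<Sum>k<length bs. \<Sum>j<length bs. \<iota> (v $ j) * (ext_scale \<iota> (vs.representation (set bs) (x * bs ! j) (bs ! k)) (bs ! k)))"
    using v by (auto simp: mult_mat_def scalar_prod_def hom_sum hom_mult sum_distrib_left atLeast0LessThan
        ext_scale_def ac_simps intro!: sum.cong)
  also have "\<dots> = (\<Sum>j<length bs. \<iota> (v $ j) * (x * bs ! j))"
    by (subst sum.swap) (simp add: sum_distrib_left[symmetric] expand_in_basis[OF hom bs])
  finally show ?thesis by (simp add: sum_distrib_left ac_simps)
qed

end

section \<open>Scalar extension of forms\<close>

lemma lookup_map_hom:
  "g 0 = 0 \<Longrightarrow> Poly_Mapping.lookup (Poly_Mapping.map g p) k = g (Poly_Mapping.lookup p k)"
  by (simp add: Poly_Mapping.map.rep_eq when_def)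

lemma extend_scalars_add:
  assumes "field_hom \<kappa>"
  shows "extend_scalars \<kappa> (p + q) = extend_scalars \<kappa> p + extend_scalars \<kappa> q"
proof -
  interpret field_hom \<kappa> by fact
  show ?thesis
    by (rule poly_mapping_eqI) (simp add: extend_scalars_def lookup_map_hom lookup_add hom_add)
qed

lemma extend_scalars_single:
  assumes "field_hom \<kappa>"
  shows "extend_scalars \<kappa> (Poly_Mapping.single m c) = Poly_Mapping.single m (\<kappa> c)"
proof -
  interpret field_hom \<kappa> by fact
  show ?thesis by (simp add: extend_scalars_def)
qed

lemma extend_scalars_0: "extend_scalars \<kappa> 0 = 0"
  by (rule poly_mapping_eqI) (simp add: extend_scalars_def Poly_Mapping.map.rep_eq)

lemma extend_scalars_mult:
  fixes p q :: "'f::field mpolynomial"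
  assumes "field_hom \<kappa>"
  shows "extend_scalars \<kappa> (p * q) = extend_scalars \<kappa> p * extend_scalars \<kappa> q"
proof -
  interpret field_hom \<kappa> by fact
  note ext = extend_scalars_add[OF assms] extend_scalars_single[OF assms]
  show ?thesis
  proof (induction p rule: pm_induct)
    case (single k c)
    show ?case
      by (induction q rule: pm_induct) (simp_all add: extend_scalars_0 ext mult_single hom_mult distrib_left)
  qed (simp_all add: extend_scalars_0 ext distrib_right)
qed

lemma comm_ring_hom_extend_scalars:
  assumes "field_hom \<kappa>"
  shows "comm_ring_hom (extend_scalars \<kappa> :: _ mpolynomial \<Rightarrow> _)"
proof -
  interpret field_hom \<kappa> by fact
  show ?thesis
  proof
    show "extend_scalars \<kappa> 1 = (1 :: _ mpolynomial)"
      using extend_scalars_single[OF assms, of 0 1] by simp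
  qed (simp_all add: extend_scalars_add[OF assms] extend_scalars_mult[OF assms]
        extend_scalars_0)
qed

text \<open>Scalar extension and evaluation are ring homomorphisms, so both pass through the
  determinant that defines the norm form.\<close>

lemma eval_extend_scalars_norm_form:
  assumes \<kappa>: "field_hom \<kappa>"
  shows "eval_form (extend_scalars \<kappa> (norm_form \<iota> bs)) v =
    det (mat (length bs) (length bs)
      (\<lambda>(i, j). \<Sum>k<length bs. \<kappa> (mult_mat \<iota> bs (bs ! k) $$ (i, j)) * v $ k))"
proof -
  interpret ex: comm_ring_hom "extend_scalars \<kappa> :: _ mpolynomial \<Rightarrow> _"
    by (rule comm_ring_hom_extend_scalars[OF \<kappa>])
  interpret ev: comm_ring_hom "\<lambda>p. eval_form p v" by (rule comm_ring_hom_eval_form)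
  show ?thesis
    unfolding norm_form_def ex.hom_det[symmetric] ev.hom_det[symmetric]
    by (rule arg_cong[where f = det], rule eq_matI)
      (simp_all add: ex.hom_sum ev.hom_sum extend_scalars_single[OF \<kappa>] eval_form_single)
qed

text \<open>\<open>is_form\<close> keeps the variables below \<open>n\<close>, where the entries of
  \<open>map_vec\<close> are determined.\<close>

lemma eval_extend_scalars:
  assumes \<kappa>: "field_hom \<kappa>" and "p \<in> carrier_vec n" and "is_form n d \<phi>"
  shows "eval_form (extend_scalars \<kappa> \<phi>) (map_vec \<kappa> p) = \<kappa> (eval_form \<phi> p)"
proof -
  interpret field_hom \<kappa> by fact
  have "Poly_Mapping.keys (extend_scalars \<kappa> \<phi>) \<subseteq> Poly_Mapping.keys \<phi>"
    by (auto simp: in_keys_iff extend_scalars_def lookup_map_hom)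
  then show ?thesis
    using assms(2,3)
    by (subst eval_form_superset[of "Poly_Mapping.keys \<phi>"])
      (auto simp: eval_form_def[of \<phi>] hom_sum hom_mult hom_prod hom_power extend_scalars_def
        lookup_map_hom is_form_def subset_iff intro!: sum.cong prod.cong arg_cong2[where f = "(*)"])
qed

lemma eval_scale_form: "eval_form (scale_form a \<phi>) v = a * eval_form \<phi> v"
proof -
  have "Poly_Mapping.keys (scale_form a \<phi>) \<subseteq> Poly_Mapping.keys \<phi>"
    by (auto simp: in_keys_iff scale_form_def lookup_map_hom)
  then show ?thesis
    by (subst eval_form_superset[of "Poly_Mapping.keys \<phi>"])
      (auto simp: eval_form_def[of \<phi>] scale_form_def lookup_map_hom sum_distrib_left mult.assoc)
qed

section \<open>The norm principle\<close>

lemma field_norm_eval_norm_form: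
  assumes \<iota>: "field_hom \<iota>" and bs: "ordered_basis \<iota> bs"
    and \<kappa>: "field_hom \<kappa>" and cs: "ordered_basis \<kappa> cs"
  shows "\<exists>x. field_norm \<kappa> (eval_form (extend_scalars \<kappa> (norm_form \<iota> bs)) v) = field_norm \<iota> x"
proof -
  let ?d = "length bs" and ?n = "length cs"
  interpret K: matrix_representation ?n "mult_mat \<kappa> cs"
    by (rule matrix_representation_mult_mat[OF \<kappa> cs])
  interpret L: matrix_representation ?d "mult_mat \<iota> bs"
    by (rule matrix_representation_mult_mat[OF \<iota> bs])
  let ?A = "\<lambda>k. mult_mat \<iota> bs (bs ! k)"
  define M where "M = mat ?d ?d (\<lambda>(i, j). \<Sum>k<?d. \<kappa> (?A k $$ (i, j)) * v $ k)"
  \<comment> \<open>The roles are exchanged: the coordinates \<open>v $ k\<close> become matrices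
    over the base field, and the basis elements of the other extension become scalars. The witness
    is \<open>det C\<close>.\<close>
  define C where "C = mat ?n ?n (\<lambda>(p, q). \<Sum>k<?d. \<iota> (mult_mat \<kappa> cs (v $ k) $$ (p, q)) * bs ! k)"
  have "field_norm \<kappa> (eval_form (extend_scalars \<kappa> (norm_form \<iota> bs)) v) = det (mult_mat \<kappa> cs (det M))"
    by (simp add: eval_extend_scalars_norm_form[OF \<kappa>] field_norm_eq[OF \<kappa> cs] M_def)
  also have "\<dots> = det (K.blocks ?d M)"
    by (rule K.det_blocks[symmetric]) (simp add: M_def)
  also have "\<dots> = det (block_mat ?n ?d (\<lambda>p q i j. mult_mat \<kappa> cs (M $$ (i, j)) $$ (p, q)))"
    by (rule det_block_mat_swap)
  \<comment> \<open>By linearity both sides have the entry sum over \<open>k\<close> of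
    \<open>?A k $$ (i, j)\<close> times
    \<open>mult_mat \<kappa> cs (v $ k) $$ (p, q)\<close>.\<close>
  also have "block_mat ?n ?d (\<lambda>p q i j. mult_mat \<kappa> cs (M $$ (i, j)) $$ (p, q)) = L.blocks ?n C"
    by (rule block_mat_cong)
      (simp add: M_def C_def mult_mat_lincomb[OF \<kappa> cs] mult_mat_lincomb[OF \<iota> bs],
        simp add: mult.commute)
  also have "det (L.blocks ?n C) = det (mult_mat \<iota> bs (det C))"
    by (rule L.det_blocks) (simp add: C_def)
  finally show ?thesis using field_norm_eq[OF \<iota> bs] by metis
qed

text \<open>Multiplicativity of the norm makes multiplication by \<open>x\<close> the required
  isomorphism; its inverse is multiplication by \<open>inverse x\<close>.\<close>

lemma field_norm_similarity_factor:
  assumes \<iota>: "field_hom \<iota>" and bs: "ordered_basis \<iota> bs" and x: "x \<noteq> 0"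
  shows "field_norm \<iota> x \<in> similarity_factors (length bs) (norm_form \<iota> bs)"
proof -
  let ?d = "length bs" and ?m = "mult_mat \<iota> bs"
  interpret L: matrix_representation ?d ?m
    by (rule matrix_representation_mult_mat[OF \<iota> bs])
  have inv: "?m y *\<^sub>v (?m z *\<^sub>v v) = v" if "y * z = 1" "v \<in> carrier_vec ?d" for y z v
    using that assoc_mult_mat_vec[OF L.carrier L.carrier that(2), of y z]
    by (simp add: L.mult[symmetric] L.one)
  have [simp]: "?m y *\<^sub>v v \<in> carrier_vec ?d" for y v
    using mult_mat_vec_carrier[OF L.carrier] by (simp add: mult_mat_vec_def mult_mat_def)
  have "bij_betw ((*\<^sub>v) (?m x)) (carrier_vec ?d) (carrier_vec ?d)"
    using x by (intro bij_betw_byWitness[where f' = "(*\<^sub>v) (?m (inverse x))"]) (auto simp: inv)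
  moreover have "eval_form (norm_form \<iota> bs) (?m x *\<^sub>v v) =
      eval_form (scale_form (field_norm \<iota> x) (norm_form \<iota> bs)) v" if "v \<in> carrier_vec ?d" for v
    by (simp add: eval_scale_form eval_norm_form[OF \<iota> bs] field_norm_mult[OF \<iota> bs]
        mult_mat_vec_coordinates[OF \<iota> bs that] del: index_mult_mat_vec)
  ultimately have "isomorphic_forms ?d (scale_form (field_norm \<iota> x) (norm_form \<iota> bs)) ?d (norm_form \<iota> bs)"
    unfolding isomorphic_forms_def
    by (intro exI[of _ "(*\<^sub>v) (?m x)"])
      (auto simp: mult_add_distrib_mat_vec[OF L.carrier] mult_mat_vec[OF L.carrier])
  then show ?thesis
    by (simp add: similarity_factors_def field_norm_nonzero[OF \<iota> bs x])
qed

theorem theorem1: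
  fixes \<iota> :: "'f::field \<Rightarrow> 'l::field"
    and \<kappa> :: "'f \<Rightarrow> 'k::field"
    and \<alpha> :: 'l and d :: nat and bs :: "'l list" and \<phi> :: "'f mpolynomial"
  assumes "field_hom \<iota>" and "simple_extension \<iota> \<alpha>"
    and "finite_extension \<iota>" and "extension_degree \<iota> = d"
    and "ordered_basis \<iota> bs" and "\<phi> = norm_form \<iota> bs"
    and "field_hom \<kappa>" and "finite_extension \<kappa>"
    and "linearly_disjoint \<iota> \<kappa>"
  shows "(\<forall>e. e \<noteq> 0 \<and> represented_by e d (extend_scalars \<kappa> \<phi>) \<longrightarrow>
              represented_by (field_norm \<kappa> e) d \<phi>) \<and>
         field_norm \<kappa> ` similarity_factors d (extend_scalars \<kappa> \<phi>) \<subseteq> similarity_factors d \<phi>"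
proof -
  note \<iota> = assms(1) and bs = assms(5) and \<kappa> = assms(7)
  have d: "d = length bs" using length_ordered_basis[OF \<iota> bs] assms(4) by simp
  obtain cs where cs: "ordered_basis \<kappa> cs" using ordered_basis_exists[OF \<kappa> assms(8)] by blast
  note norm = field_norm_eval_norm_form[OF \<iota> bs \<kappa> cs]
  have "field_norm \<kappa> a \<in> similarity_factors d \<phi>"
    if a: "a \<in> similarity_factors d (extend_scalars \<kappa> \<phi>)" for a
  proof -
    obtain f where f: "\<And>v. v \<in> carrier_vec d \<Longrightarrow>
        eval_form (extend_scalars \<kappa> \<phi>) (f v) = eval_form (scale_form a (extend_scalars \<kappa> \<phi>)) v"
      using a unfolding similarity_factors_def isomorphic_forms_def by blast
    \<comment> \<open>The norm form takes the value 1 at the coordinates of the unit element, and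
      scalar extension preserves this. The similarity \<open>f\<close> carries that vector to one
      where the extended form has the value \<open>a\<close>.\<close>
    have "represented_by 1 d \<phi>"
      using represented_by_norm_form_iff[OF \<iota> bs, of 1] field_norm_1[OF \<iota> bs] assms(6) d by metis
    then obtain v where v: "v \<in> carrier_vec d" "eval_form \<phi> v = 1"
      by (auto simp: represented_by_def)
    have "eval_form (extend_scalars \<kappa> \<phi>) (map_vec \<kappa> v) = \<kappa> 1"
      using eval_extend_scalars[OF \<kappa> v(1), of d \<phi>] is_form_norm_form[of bs \<iota>] assms(6) d v(2) by simp
    moreover have "\<kappa> 1 = 1"
    proof -
      interpret field_hom \<kappa> by (rule \<kappa>)
      show ?thesis by simp
    qed
    ultimately have "a = eval_form (extend_scalars \<kappa> \<phi>) (f (map_vec \<kappa> v))"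
      using f[of "map_vec \<kappa> v"] v(1) by (simp add: eval_scale_form)
    then obtain x where x: "field_norm \<kappa> a = field_norm \<iota> x"
      using norm assms(6) by blast
    \<comment> \<open>Similarity factors are nonzero, and nonzero elements have nonzero norm; as 0
      has norm 0, \<open>x\<close> cannot vanish.\<close>
    have "field_norm \<iota> x \<noteq> 0"
      using field_norm_nonzero[OF \<kappa> cs, of a] a x by (simp add: similarity_factors_def)
    then have "x \<noteq> 0" using field_norm_0[OF \<iota> bs] by auto
    then show ?thesis
      using field_norm_similarity_factor[OF \<iota> bs, of x] x assms(6) d by auto
  qed
  moreover have "represented_by (field_norm \<kappa> e) d \<phi>"
    if "represented_by e d (extend_scalars \<kappa> \<phi>)" for e
    using that norm represented_by_norm_form_iff[OF \<iota> bs] assms(6) d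
    by (auto simp: represented_by_def[of e])
  ultimately show ?thesis by blast
qed

end
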